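(* Let $0<r<1$, $k=\sqrt{1-r^2}$, $z\in\mathbb{C}$. Let $\mathcal{D}_r$ be the fourth order differential operator $$\mathcal{D}_r=z^2\frac{d^4}{dz^4}+2z\frac{d^3}{dz^3}-(1+r^2)z^2\frac{d^2}{dz^2}-(1+r^2)z\frac{d}{dz}+r^2z^2=z\left(\frac{d^2}{dz^2}z\frac{d^2}{dz^2}-\frac{d}{dz}(1+r^2)z\frac{d}{dz}+r^2z\right).$$ For integers $n\ge0$ let $\tilde\Phi_{r,n}(z)=\frac1\pi\int_0^\pi e^{-z\operatorname{dn}(K(k)\theta/\pi,k)}\cos(n\theta)\,d\theta$. Then $$\mathcal{D}_r\tilde\Phi_{r,n}(z)=\frac{n^2\pi^2}{K(k)^2}\,\tilde\Phi_{r,n}(z)\qquad\text{for all integers } n\ge0.$$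
   Context: $K(k)=\int_0^{\pi/2}(1-k^2\sin^2\theta)^{-1/2}d\theta$ is the complete elliptic integral of the first kind with modulus $k$, and $\operatorname{dn}(\cdot,k)$ is Jacobi's delta amplitude function with modulus $k$. In the factored form of $\mathcal{D}_r$, products denote composition of operators (functions act by multiplication). *)

theory Defs
  imports "HOL-Complex_Analysis.Complex_Analysis"
begin

text \<open>All elliptic functions are parametrised by the modulus \<open>k\<close> (not the parameter \<open>m = k\<^sup>2\<close>).\<close>

definition ellint_K :: "real \<Rightarrow> real" where
  "ellint_K k = (LBINT t=0..pi/2. 1 / sqrt (1 - k^2 * (sin t)^2))"

text \<open>Incomplete elliptic integral of the first kind. The interval integral is oriented, so this is
  the odd function of \<open>phi\<close> also for \<open>phi < 0\<close>.\<close>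
definition ellint_F :: "real \<Rightarrow> real \<Rightarrow> real" where
  "ellint_F phi k = (LBINT t=0..phi. 1 / sqrt (1 - k^2 * (sin t)^2))"

text \<open>For \<open>-1 < k < 1\<close> the map \<open>phi \<mapsto> ellint_F phi k\<close> is an increasing bijection of the real line;
  the amplitude is its inverse, and \<open>dn\<close> is \<open>\<Delta>(\<phi>) = sqrt (1 - k\<^sup>2 sin\<^sup>2 \<phi>)\<close> taken at the amplitude.
  Only real arguments are covered.\<close>
definition jacobi_am :: "real \<Rightarrow> real \<Rightarrow> real" where
  "jacobi_am u k = (THE phi. ellint_F phi k = u)"

definition jacobi_dn :: "real \<Rightarrow> real \<Rightarrow> real" where
  "jacobi_dn u k = sqrt (1 - k^2 * (sin (jacobi_am u k))^2)"

definition D_op :: "real \<Rightarrow> (complex \<Rightarrow> complex) \<Rightarrow> complex \<Rightarrow> complex" where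
  "D_op r f z = z^2 * (deriv ^^ 4) f z + 2 * z * (deriv ^^ 3) f z
     - (1 + of_real r^2) * z^2 * (deriv ^^ 2) f z - (1 + of_real r^2) * z * deriv f z
     + of_real r^2 * z^2 * f z"

text \<open>The factored form of the operator agrees with the expanded one on holomorphic functions.\<close>
lemma D_op_factored:
  assumes f: "f holomorphic_on S" and S: "open S" and z: "z \<in> S"
  shows "D_op r f z =
    z * ((deriv ^^ 2) (\<lambda>w. w * (deriv ^^ 2) f w) z
         - deriv (\<lambda>w. (1 + of_real r^2) * w * deriv f w) z
         + of_real r^2 * z * f z)"
proof -
  have hol: "(deriv ^^ n) f holomorphic_on S" for n
    by (rule holomorphic_higher_deriv[OF f S])
  have D: "((deriv ^^ n) f has_field_derivative (deriv ^^ Suc n) f w) (at w)" if "w \<in> S" for n w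
    using holomorphic_derivI[OF hol S that] by simp
  have d2: "deriv (\<lambda>w. w * (deriv ^^ 2) f w) w = (deriv ^^ 2) f w + w * (deriv ^^ 3) f w"
    if "w \<in> S" for w
    using D[OF that, of 2]
    by (intro DERIV_imp_deriv) (auto intro!: derivative_eq_intros simp: eval_nat_numeral)
  have ev: "\<forall>\<^sub>F w in nhds z. deriv (\<lambda>w. w * (deriv ^^ 2) f w) w = (deriv ^^ 2) f w + w * (deriv ^^ 3) f w"
    using eventually_nhds_in_open[OF S z] by eventually_elim (rule d2)
  have "(deriv ^^ 2) (\<lambda>w. w * (deriv ^^ 2) f w) z = deriv (deriv (\<lambda>w. w * (deriv ^^ 2) f w)) z"
    by (simp add: numeral_2_eq_2)
  also have "\<dots> = deriv (\<lambda>w. (deriv ^^ 2) f w + w * (deriv ^^ 3) f w) z"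
    by (rule deriv_cong_ev[OF ev refl])
  also have "\<dots> = 2 * (deriv ^^ 3) f z + z * (deriv ^^ 4) f z"
    using D[OF z, of 2] D[OF z, of 3]
    by (intro DERIV_imp_deriv) (auto intro!: derivative_eq_intros simp: eval_nat_numeral)
  finally have a: "(deriv ^^ 2) (\<lambda>w. w * (deriv ^^ 2) f w) z
      = 2 * (deriv ^^ 3) f z + z * (deriv ^^ 4) f z" .
  have b: "deriv (\<lambda>w. (1 + of_real r^2) * w * deriv f w) z
      = (1 + of_real r^2) * (deriv f z + z * (deriv ^^ 2) f z)"
    using D[OF z, of 1]
    by (intro DERIV_imp_deriv)
       (auto intro!: derivative_eq_intros simp: eval_nat_numeral algebra_simps)
  show ?thesis
    unfolding D_op_def a b by (simp add: algebra_simps power2_eq_square)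
qed

definition Phi :: "real \<Rightarrow> nat \<Rightarrow> complex \<Rightarrow> complex" where
  "Phi r n z = (let k = sqrt (1 - r^2) in
     1 / of_real pi *
       (LBINT t=0..pi. exp (- z * of_real (jacobi_dn (ellint_K k * t / pi) k))
                         * of_real (cos (real n * t))))"

end

theory Submission imports Defs begin

text \<open>The function \<open>dn\<close> satisfies \<open>(dn')\<^sup>2 = (1 - dn\<^sup>2) (dn\<^sup>2 - r\<^sup>2)\<close> and
  \<open>dn'' = (1 + r\<^sup>2) dn - 2 dn\<^sup>3\<close>, so that applying the operator to the kernel \<open>exp (- z dn u)\<close> in
  the variable \<open>z\<close> amounts to applying \<open>- d\<^sup>2/du\<^sup>2\<close>. Since \<open>dn'\<close> vanishes at \<open>0\<close> and \<open>K\<close>,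
  integrating by parts twice moves this onto \<open>cos (n t)\<close> without boundary terms.\<close>

section \<open>The incomplete elliptic integral and its inverse, the amplitude\<close>

lemma one_minus_sin_pos:
  fixes k :: real
  assumes "k^2 < 1"
  shows "0 < 1 - k^2 * (sin x)^2"
proof -
  have "k^2 * (sin x)^2 \<le> k^2 * 1"
    by (intro mult_left_mono) (auto simp: abs_square_le_1)
  with assms show ?thesis by simp
qed

lemma ellint_F_0 [simp]: "ellint_F 0 k = 0"
  by (simp add: ellint_F_def zero_ereal_def)

lemma ellint_K_eq_F: "ellint_K k = ellint_F (pi/2) k"
  by (simp add: ellint_K_def ellint_F_def)

lemma ellint_F_has_real_derivative:
  fixes k :: real
  assumes k: "k^2 < 1"
  shows "((\<lambda>p. ellint_F p k) has_real_derivative 1 / sqrt (1 - k^2 * (sin x)^2)) (at x)"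
proof -
  let ?f = "\<lambda>t. 1 / sqrt (1 - k^2 * (sin t)^2)"
  \<comment> \<open>The interval has both the base point 0 and \<open>x\<close> in its interior, so
    either sign of \<open>x\<close> is covered and the derivative within the interval is
    two-sided.\<close>
  let ?a = "- \<bar>x\<bar> - 1" and ?b = "\<bar>x\<bar> + 1"
  have "sqrt (1 - k^2 * (sin t)^2) \<noteq> 0" for t
    using one_minus_sin_pos[OF k, of t] by simp
  then have cont: "continuous_on {?a..?b} ?f"
    by (intro continuous_intros) auto
  have "((\<lambda>u. LBINT y=ereal 0..u. ?f y) has_vector_derivative ?f x) (at x within {?a..?b})"
    by (rule interval_integral_FTC2[OF _ _ cont]) auto
  then show ?thesis
    by (simp add: ellint_F_def zero_ereal_def has_real_derivative_iff_has_vector_derivative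
        at_within_Icc_at)
qed

lemma strict_mono_ellint_F:
  assumes k: "k^2 < 1"
  shows "strict_mono (\<lambda>p. ellint_F p k)"
proof (rule strict_monoI)
  fix x y :: real assume "x < y"
  then show "ellint_F x k < ellint_F y k"
  proof (rule DERIV_pos_imp_increasing)
    fix p
    show "\<exists>d. ((\<lambda>p. ellint_F p k) has_real_derivative d) (at p) \<and> 0 < d"
      using ellint_F_has_real_derivative[OF k, of p] one_minus_sin_pos[OF k, of p]
      by (intro exI conjI) auto
  qed
qed

text \<open>The integrand is at least 1, so \<open>ellint_F p k - p\<close> is nondecreasing and
  vanishes at 0. The value \<open>u\<close> is therefore bracketed by those at
  \<open>-\<bar>u\<bar>\<close> and \<open>\<bar>u\<bar>\<close>.\<close>

lemma surj_ellint_F: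
  assumes k: "k^2 < 1"
  shows "\<exists>p. ellint_F p k = u"
proof -
  have D: "((\<lambda>p. ellint_F p k - p) has_real_derivative 1 / sqrt (1 - k^2 * (sin x)^2) - 1) (at x)" for x
    by (intro DERIV_diff ellint_F_has_real_derivative[OF k] DERIV_ident)
  have nonneg: "0 \<le> 1 / sqrt (1 - k^2 * (sin x)^2) - 1" for x
    using one_minus_sin_pos[OF k, of x] by simp
  have mono: "ellint_F x k - x \<le> ellint_F y k - y" if "x \<le> y" for x y
    by (rule DERIV_nonneg_imp_nondecreasing[OF that]) (use D nonneg in blast)
  have "continuous_on {-\<bar>u\<bar>..\<bar>u\<bar>} (\<lambda>p. ellint_F p k)"
    using ellint_F_has_real_derivative[OF k]
    by (meson DERIV_continuous continuous_at_imp_continuous_on)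
  moreover have "ellint_F (-\<bar>u\<bar>) k \<le> u" "u \<le> ellint_F \<bar>u\<bar> k"
    using mono[of "-\<bar>u\<bar>" 0] mono[of 0 "\<bar>u\<bar>"] by auto
  ultimately show ?thesis
    using IVT'[of "\<lambda>p. ellint_F p k" "-\<bar>u\<bar>" u "\<bar>u\<bar>"] by auto
qed

lemma jacobi_am_ellint_F [simp]:
  assumes "k^2 < 1"
  shows "jacobi_am (ellint_F p k) k = p"
  unfolding jacobi_am_def
  using strict_mono_eq[OF strict_mono_ellint_F[OF assms]] by (intro the_equality) auto

lemma ellint_F_jacobi_am [simp]:
  assumes "k^2 < 1"
  shows "ellint_F (jacobi_am u k) k = u"
  using surj_ellint_F[OF assms, of u] jacobi_am_ellint_F[OF assms] by auto

lemma jacobi_am_has_real_derivative: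
  assumes k: "k^2 < 1"
  shows "((\<lambda>u. jacobi_am u k) has_real_derivative jacobi_dn u k) (at u)"
proof -
  \<comment> \<open>The inverse function rule takes continuity of the inverse as a premise. It is
    first obtained at an image point of \<open>ellint_F\<close>, which is \<open>u\<close>
    itself.\<close>
  have "isCont (\<lambda>u. jacobi_am u k) (ellint_F (jacobi_am u k) k)"
    by (rule isCont_inverse_function[where d = 1 and f = "\<lambda>p. ellint_F p k"])
       (use ellint_F_has_real_derivative[OF k] in \<open>auto simp: k intro: DERIV_isCont\<close>)
  then have cont: "isCont (\<lambda>u. jacobi_am u k) u"
    by (simp add: k)
  have "((\<lambda>u. jacobi_am u k) has_real_derivative
      inverse (1 / sqrt (1 - k^2 * (sin (jacobi_am u k))^2))) (at u)"
    by (rule DERIV_inverse_function[where f = "\<lambda>p. ellint_F p k" and a = "u - 1" and b = "u + 1"])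
       (use ellint_F_has_real_derivative[OF k] one_minus_sin_pos[OF k, of "jacobi_am u k"] cont
         in \<open>auto simp: k\<close>)
  then show ?thesis by (simp add: jacobi_dn_def)
qed

section \<open>The differential equations of \<open>dn\<close>\<close>

lemma jacobi_dn_pos: "k^2 < 1 \<Longrightarrow> 0 < jacobi_dn u k"
  using one_minus_sin_pos by (simp add: jacobi_dn_def)

lemma jacobi_dn_squared: "k^2 < 1 \<Longrightarrow> (jacobi_dn u k)^2 = 1 - k^2 * (sin (jacobi_am u k))^2"
  using one_minus_sin_pos[of k "jacobi_am u k"] by (simp add: jacobi_dn_def)

text \<open>This is the classical \<open>- k^2 sn cn\<close>, with \<open>sn\<close> and
  \<open>cn\<close> the sine and cosine of the amplitude. The closed form makes its zeros and its
  own derivative accessible.\<close>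

definition jacobi_dn' :: "real \<Rightarrow> real \<Rightarrow> real" where
  "jacobi_dn' u k = - (k^2 * sin (jacobi_am u k) * cos (jacobi_am u k))"

lemma jacobi_dn_has_real_derivative:
  assumes k: "k^2 < 1"
  shows "((\<lambda>u. jacobi_dn u k) has_real_derivative jacobi_dn' u k) (at u)"
proof -
  have "((\<lambda>u. sqrt (1 - k^2 * (sin (jacobi_am u k))^2)) has_real_derivative
     - (k^2 * (2 * sin (jacobi_am u k) * (cos (jacobi_am u k) * jacobi_dn u k)))
       * (inverse (sqrt (1 - k^2 * (sin (jacobi_am u k))^2)) / 2)) (at u)"
    using one_minus_sin_pos[OF k, of "jacobi_am u k"]
    by (auto intro!: derivative_eq_intros jacobi_am_has_real_derivative[OF k])
  then show ?thesis
    using jacobi_dn_pos[OF k, of u]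
    by (simp add: jacobi_dn_def[symmetric] jacobi_dn'_def field_simps)
qed

text \<open>Differentiation gives \<open>- k^2 (cn^2 - sn^2) dn\<close>; substituting
  \<open>k^2 sn^2 = 1 - dn^2\<close> leaves a polynomial in \<open>dn\<close>. For
  \<open>k^2 = 1 - r^2\<close> the linear coefficient is \<open>1 + r^2\<close>.\<close>

lemma jacobi_dn'_has_real_derivative:
  assumes k: "k^2 < 1"
  shows "((\<lambda>u. jacobi_dn' u k) has_real_derivative
    (2 - k^2) * jacobi_dn u k - 2 * (jacobi_dn u k)^3) (at u)"
proof -
  have "((\<lambda>u. jacobi_dn' u k) has_real_derivative
    - (k^2 * ((cos (jacobi_am u k))^2 - (sin (jacobi_am u k))^2) * jacobi_dn u k)) (at u)"
    unfolding jacobi_dn'_def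
    by (auto intro!: derivative_eq_intros jacobi_am_has_real_derivative[OF k]
        simp: algebra_simps power2_eq_square)
  also have "- (k^2 * ((cos (jacobi_am u k))^2 - (sin (jacobi_am u k))^2) * jacobi_dn u k)
    = (2 - k^2 - 2 * (jacobi_dn u k)^2) * jacobi_dn u k"
    by (simp add: jacobi_dn_squared[OF k] cos_squared_eq algebra_simps)
  finally show ?thesis
    by (simp add: algebra_simps power2_eq_square power3_eq_cube)
qed

text \<open>The two factors are \<open>k^2 sn^2\<close> and \<open>k^2 cn^2\<close>, rewritten in
  terms of \<open>dn\<close>.\<close>

lemma jacobi_dn'_squared:
  assumes k: "k^2 < 1"
  shows "(jacobi_dn' u k)^2 = (1 - (jacobi_dn u k)^2) * ((jacobi_dn u k)^2 - (1 - k^2))"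
  by (simp add: jacobi_dn'_def jacobi_dn_squared[OF k] cos_squared_eq power_mult_distrib)
     (simp add: algebra_simps power2_eq_square power4_eq_xxxx)

lemma jacobi_dn'_0: "k^2 < 1 \<Longrightarrow> jacobi_dn' 0 k = 0"
  using jacobi_am_ellint_F[of k 0] by (simp add: jacobi_dn'_def)

text \<open>The amplitude of \<open>K\<close> is \<open>pi/2\<close>, where the cosine
  vanishes.\<close>

lemma jacobi_dn'_ellint_K: "k^2 < 1 \<Longrightarrow> jacobi_dn' (ellint_K k) k = 0"
  using jacobi_am_ellint_F[of k "pi/2"] by (simp add: jacobi_dn'_def ellint_K_eq_F)

lemma ellint_K_pos: "k^2 < 1 \<Longrightarrow> 0 < ellint_K k"
  using strict_monoD[OF strict_mono_ellint_F, of k 0 "pi/2"] by (simp add: ellint_K_eq_F)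

section \<open>The operator under the integral sign\<close>

text \<open>The integrand is entire in \<open>z\<close> and its \<open>z\<close>-derivative is
  jointly continuous, so the Leibniz rule applies. The power \<open>m\<close> is kept general so
  that the rule can be iterated.\<close>

lemma deriv_integral_exp:
  fixes y g :: "real \<Rightarrow> complex"
  assumes y: "continuous_on {a..b} y" and g: "continuous_on {a..b} g"
  shows "((\<lambda>z. integral {a..b} (\<lambda>t. (- y t)^m * exp (- z * y t) * g t)) has_field_derivative
     integral {a..b} (\<lambda>t. (- y t)^Suc m * exp (- z * y t) * g t)) (at z)"
proof -
  have "((\<lambda>z. integral (cbox a b) (\<lambda>t. (- y t)^m * exp (- z * y t) * g t)) has_field_derivative
     integral (cbox a b) (\<lambda>t. (- y t)^Suc m * exp (- z * y t) * g t)) (at z within UNIV)"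
  proof (rule leibniz_rule_field_derivative)
    fix z t
    show "((\<lambda>z. (- y t)^m * exp (- z * y t) * g t) has_field_derivative
      (- y t)^Suc m * exp (- z * y t) * g t) (at z within UNIV)"
      by (auto intro!: derivative_eq_intros)
    show "(\<lambda>t. (- y t)^m * exp (- z * y t) * g t) integrable_on cbox a b"
      by (intro integrable_continuous) (auto intro!: continuous_intros y g)
    have "continuous_on (UNIV \<times> {a..b}) (\<lambda>p :: complex \<times> real. y (snd p))"
         "continuous_on (UNIV \<times> {a..b}) (\<lambda>p :: complex \<times> real. g (snd p))"
      by (auto intro!: continuous_on_compose2[OF y] continuous_on_compose2[OF g] continuous_intros)
    then show "continuous_on (UNIV \<times> cbox a b)
        (\<lambda>(z, t). (- y t)^Suc m * exp (- z * y t) * g t)"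
      unfolding case_prod_beta by (intro continuous_intros) simp_all
  qed auto
  then show ?thesis by simp
qed

lemma higher_deriv_integral_exp:
  fixes y g :: "real \<Rightarrow> complex"
  assumes "continuous_on {a..b} y" and "continuous_on {a..b} g"
  shows "(deriv ^^ m) (\<lambda>z. integral {a..b} (\<lambda>t. exp (- z * y t) * g t)) =
     (\<lambda>z. integral {a..b} (\<lambda>t. (- y t)^m * exp (- z * y t) * g t))"
proof (induction m)
  case (Suc m)
  show ?case
    unfolding funpow.simps comp_def Suc.IH
    by (intro ext DERIV_imp_deriv deriv_integral_exp[OF assms])
qed simp

text \<open>Each derivative in \<open>z\<close> brings down a factor \<open>- y t\<close>. The terms
  with \<open>z^2\<close> collect to \<open>y^4 - (1 + r^2) y^2 + r^2\<close>, which factors as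
  shown; the two terms with a single \<open>z\<close> give the cubic.\<close>

lemma D_op_integral_exp:
  fixes y g :: "real \<Rightarrow> complex"
  assumes y: "continuous_on {a..b} y" and g: "continuous_on {a..b} g"
  shows "D_op r (\<lambda>z. integral {a..b} (\<lambda>t. exp (- z * y t) * g t)) z =
     integral {a..b} (\<lambda>t. (z^2 * (1 - (y t)^2) * (of_real r^2 - (y t)^2)
        + z * ((1 + of_real r^2) * y t - 2 * (y t)^3)) * exp (- z * y t) * g t)"
proof -
  let ?E = "\<lambda>m t. (- y t)^m * exp (- z * y t) * g t"
  have E: "(?E m has_integral (deriv ^^ m) (\<lambda>z. integral {a..b} (\<lambda>t. exp (- z * y t) * g t)) z) {a..b}" for m
    unfolding higher_deriv_integral_exp[OF y g]
    by (intro integrable_integral integrable_continuous_interval continuous_intros y g)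
  let ?c = "1 + of_real r^2 :: complex"
  have "((\<lambda>t. z^2 * ?E 4 t + 2 * z * ?E 3 t - ?c * z^2 * ?E 2 t - ?c * z * ?E 1 t
      + of_real r^2 * z^2 * ?E 0 t) has_integral
      D_op r (\<lambda>z. integral {a..b} (\<lambda>t. exp (- z * y t) * g t)) z) {a..b}"
    unfolding D_op_def using E[of 4] E[of 3] E[of 2] E[of 1] E[of 0]
    by (intro has_integral_add has_integral_diff has_integral_mult_right) simp_all
  then show ?thesis
    by (rule integral_unique[symmetric, OF has_integral_eq[rotated]])
       (simp add: algebra_simps eval_nat_numeral)
qed

text \<open>Integration by parts twice, packaged as the fundamental theorem applied to
  \<open>E' cos (n t) + n E sin (n t)\<close>.\<close>
lemma integral_second_derivative_cos:
  fixes E E' E'' :: "real \<Rightarrow> complex"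
  assumes E: "\<And>t. (E has_vector_derivative E' t) (at t)"
    and E': "\<And>t. (E' has_vector_derivative E'' t) (at t)"
    and bd: "E' 0 = 0" "E' pi = 0"
  shows "((\<lambda>t. - E'' t * of_real (cos (real n * t))) has_integral
    of_real ((real n)^2) * integral {0..pi} (\<lambda>t. E t * of_real (cos (real n * t)))) {0..pi}"
proof -
  let ?c = "\<lambda>t. complex_of_real (cos (real n * t))"
  let ?s = "\<lambda>t. complex_of_real (sin (real n * t))"
  have s: "(?s has_vector_derivative of_real (real n) * ?c t) (at t)" for t
    using has_vector_derivative_of_real[of "\<lambda>t. sin (real n * t)" "real n * cos (real n * t)" "at t"]
    by (auto intro!: derivative_eq_intros simp: has_real_derivative_iff_has_vector_derivative[symmetric])
  have c: "(?c has_vector_derivative - of_real (real n) * ?s t) (at t)" for t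
    using has_vector_derivative_of_real[of "\<lambda>t. cos (real n * t)" "- real n * sin (real n * t)" "at t"]
    by (auto intro!: derivative_eq_intros simp: has_real_derivative_iff_has_vector_derivative[symmetric])
  have D: "((\<lambda>t. E' t * ?c t + of_real (real n) * (E t * ?s t)) has_vector_derivative
      E'' t * ?c t + of_real ((real n)^2) * (E t * ?c t)) (at t)" for t
    by (rule has_vector_derivative_eq_rhs[OF has_vector_derivative_add
          [OF has_vector_derivative_mult[OF E' c]
            has_vector_derivative_mult_right[OF has_vector_derivative_mult[OF E s]]]])
       (simp add: algebra_simps power2_eq_square)
  have "((\<lambda>t. E'' t * ?c t + of_real ((real n)^2) * (E t * ?c t)) has_integral
      (E' pi * ?c pi + of_real (real n) * (E pi * ?s pi)) - (E' 0 * ?c 0 + of_real (real n) * (E 0 * ?s 0))) {0..pi}"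
    by (rule fundamental_theorem_of_calculus[OF pi_ge_zero has_vector_derivative_at_within[OF D]])
  \<comment> \<open>The boundary terms with \<open>E'\<close> vanish by hypothesis, those with the
    sine because \<open>n\<close> is an integer.\<close>
  then have 1: "((\<lambda>t. E'' t * ?c t + of_real ((real n)^2) * (E t * ?c t)) has_integral 0) {0..pi}"
    by (simp add: bd)
  have "continuous_on {0..pi} E"
    using E by (meson continuous_at_imp_continuous_on has_vector_derivative_continuous)
  then have "((\<lambda>t. of_real ((real n)^2) * (E t * ?c t)) has_integral
      of_real ((real n)^2) * integral {0..pi} (\<lambda>t. E t * ?c t)) {0..pi}"
    by (intro has_integral_mult_right integrable_integral integrable_continuous_interval continuous_intros)
  from has_integral_diff[OF this 1] show ?thesis by simp
qed

section \<open>Rescaling to the interval from 0 to \<open>pi\<close>, and the eigenvalue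
  equation\<close>

theorem theorem3p19:
  fixes r k :: real and n :: nat and z :: complex
  assumes "0 < r" and "r < 1" and "k = sqrt (1 - r^2)"
  shows "Phi r n holomorphic_on UNIV
    \<and> D_op r (Phi r n) z = of_real ((real n)^2 * pi^2 / (ellint_K k)^2) * Phi r n z"
proof -
  have r2: "r^2 < 1" using assms by (simp add: power_less_one_iff)
  have k2: "k^2 = 1 - r^2" using r2 assms by simp
  have k: "k^2 < 1" using k2 assms by simp
  \<comment> \<open>The factor \<open>c\<close> maps the range of integration onto the interval from
    0 to \<open>K\<close>. The eigenvalue will appear as \<open>n^2 / c^2\<close>.\<close>
  define c where "c = ellint_K k / pi"
  have c: "c > 0" using ellint_K_pos[OF k] by (simp add: c_def)
  define y where "y t = jacobi_dn (c * t) k" for t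
  define y' where "y' t = c * jacobi_dn' (c * t) k" for t
  define y'' where "y'' t = c^2 * ((1 + r^2) * y t - 2 * (y t)^3)" for t
  have y: "(y has_real_derivative y' t) (at t)" for t
    unfolding y_def y'_def
    by (rule DERIV_cong[OF DERIV_chain2[OF jacobi_dn_has_real_derivative[OF k] DERIV_cmult_Id] mult.commute])
  have y': "(y' has_real_derivative y'' t) (at t)" for t
    unfolding y'_def
    by (rule DERIV_cong[OF DERIV_cmult
          [OF DERIV_chain2[OF jacobi_dn'_has_real_derivative[OF k] DERIV_cmult_Id]]])
       (simp add: y_def y''_def k2 power2_eq_square[of c])
  have y'_sq: "(y' t)^2 = c^2 * ((1 - (y t)^2) * ((y t)^2 - r^2))" for t
    by (simp add: y'_def y_def jacobi_dn'_squared[OF k] k2 power_mult_distrib)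
  have y'_bd: "y' 0 = 0" "y' pi = 0"
    using jacobi_dn'_0[OF k] jacobi_dn'_ellint_K[OF k] by (simp_all add: y'_def c_def)
  let ?Y = "\<lambda>t. complex_of_real (y t)"
  \<comment> \<open>The prefactor \<open>1 / pi\<close> is absorbed into the weight, so that
    \<open>Phi\<close> is exactly an integral of the kernel against \<open>?g\<close>.\<close>
  let ?g = "\<lambda>t. complex_of_real (cos (real n * t)) / of_real pi"
  have contY: "continuous_on {0..pi} ?Y"
    using y by (intro continuous_intros) (meson DERIV_isCont continuous_at_imp_continuous_on)
  have contg: "continuous_on {0..pi} ?g"
    by (intro continuous_intros) auto
  have Phi: "Phi r n = (\<lambda>z. integral {0..pi} (\<lambda>t. exp (- z * ?Y t) * ?g t))"
  proof
    fix z
    have "continuous_on {0..pi} (\<lambda>t. exp (- z * ?Y t) * of_real (cos (real n * t)))"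
      by (intro continuous_intros contY)
    then have "set_integrable lborel {0..pi} (\<lambda>t. exp (- z * ?Y t) * of_real (cos (real n * t)))"
      by (rule borel_integrable_atLeastAtMost')
    then have "(LBINT t=ereal 0..ereal pi. exp (- z * ?Y t) * of_real (cos (real n * t))) =
       integral {0..pi} (\<lambda>t. exp (- z * ?Y t) * of_real (cos (real n * t)))"
      by (intro interval_integral_eq_integral) auto
    then show "Phi r n z = integral {0..pi} (\<lambda>t. exp (- z * ?Y t) * ?g t)"
      by (simp add: Phi_def Let_def assms(3)[symmetric] zero_ereal_def y_def c_def)
  qed
  have hol: "Phi r n holomorphic_on UNIV"
    using deriv_integral_exp[OF contY contg, of 0] unfolding Phi
    by (auto simp: holomorphic_on_open)
  define E where "E t = exp (- z * ?Y t)" for t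
  define E' where "E' t = - z * of_real (y' t) * E t" for t
  define E'' where "E'' t = (z^2 * of_real (y' t)^2 - z * of_real (y'' t)) * E t" for t
  have vY: "(?Y has_vector_derivative of_real (y' t)) (at t)" for t
    using y has_vector_derivative_of_real by blast
  have vY': "((\<lambda>t. complex_of_real (y' t)) has_vector_derivative of_real (y'' t)) (at t)" for t
    using y' has_vector_derivative_of_real by blast
  have dE: "(E has_vector_derivative E' t) (at t)" for t
  proof -
    have "((\<lambda>x. exp (- z * x)) has_field_derivative - z * exp (- z * ?Y t)) (at (?Y t))"
      by (auto intro!: derivative_eq_intros)
    from field_vector_diff_chain_at[OF vY this] show ?thesis
      by (simp add: o_def E_def[abs_def] E'_def mult_ac)
  qed
  have dE': "(E' has_vector_derivative E'' t) (at t)" for t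
    unfolding E'_def
    by (rule has_vector_derivative_eq_rhs[OF has_vector_derivative_mult
          [OF has_vector_derivative_mult_right[OF vY'] dE]])
       (simp add: E''_def E'_def algebra_simps power2_eq_square)
  have "((\<lambda>t. - E'' t * of_real (cos (real n * t))) has_integral
      of_real ((real n)^2) * integral {0..pi} (\<lambda>t. E t * of_real (cos (real n * t)))) {0..pi}"
    by (rule integral_second_derivative_cos[OF dE dE']) (simp_all add: E'_def y'_bd)
  \<comment> \<open>Dividing by \<open>c^2\<close> undoes the rescaling of the second derivative;
    dividing by \<open>pi\<close> turns the cosine into \<open>?g\<close>.\<close>
  from has_integral_mult_right[OF this, of "1 / of_real (c^2 * pi)"]
  have I: "((\<lambda>t. - (E'' t / of_real (c^2)) * ?g t) has_integral
      of_real ((real n)^2 / c^2) * Phi r n z) {0..pi}"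
    by (simp add: Phi E_def mult_ac)
  \<comment> \<open>The right-hand side is the kernel produced by \<open>D_op_integral_exp\<close>.
    The minus sign turns \<open>y^2 - r^2\<close> from the first-order equation for
    \<open>dn\<close> into \<open>r^2 - y^2\<close>, and the second-order equation supplies the
    cubic.\<close>
  have kernel: "- (E'' t / of_real (c^2)) =
      (z^2 * (1 - (?Y t)^2) * (of_real r^2 - (?Y t)^2)
        + z * ((1 + of_real r^2) * ?Y t - 2 * (?Y t)^3)) * exp (- z * ?Y t)" for t
  proof -
    have sq: "complex_of_real (y' t)^2 = of_real (c^2) * ((1 - (?Y t)^2) * ((?Y t)^2 - of_real r^2))"
      unfolding of_real_power[symmetric] y'_sq by simp
    have y'': "complex_of_real (y'' t) = of_real (c^2) * ((1 + of_real r^2) * ?Y t - 2 * (?Y t)^3)"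
      by (simp add: y''_def)
    show ?thesis
      unfolding E''_def E_def sq y'' using c by (simp add: field_simps)
  qed
  have "D_op r (Phi r n) z = of_real ((real n)^2 / c^2) * Phi r n z"
    using integral_unique[OF I] unfolding kernel
    by (subst Phi, subst D_op_integral_exp[OF contY contg]) simp
  with hol show ?thesis
    by (simp add: c_def power_divide)
qed

end
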